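(* Let $G=(V,E)$ be a finite simple graph with vertex set $V=\{v_1,\dots,v_n\}$, and assume every vertex has positive degree. Let $D\in\mathbb{R}^{n\times n}$ be the diagonal matrix with $D_{ii}=\deg(v_i)$ and $A\in\{0,1\}^{n\times n}$ the adjacency matrix of $G$. Let $x\in\mathbb{R}^n$ be a solution (minimizer) of the quadratic program $$\min_{x\in\mathbb{R}^n}\ \langle x, D^{-1}AD^{-1}x\rangle \quad\text{subject to}\quad 0\le x_i\le \deg(v_i)\ \text{for all } i,\quad \sum_{i=1}^n x_i\ge |E|.$$ Let $C=\{v_i\in V: x_i\ge 0.23\cdot\deg(v_i)\}$. If $\textsc{MaxCut}(G)\ge 0.995\cdot|E|$, then $$\#E(C,V\setminus C)\ge 0.502\cdot \textsc{MaxCut}(G).$$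
   Context: For disjoint vertex sets $S,T\subseteq V$, $\#E(S,T)$ denotes the number of edges with one endpoint in $S$ and the other in $T$. $\textsc{MaxCut}(G)=\max_{A,B\subseteq V,\ A\cap B=\emptyset}\#E(A,B)$. $\langle\cdot,\cdot\rangle$ is the standard inner product on $\mathbb{R}^n$. *)

theory Defs
  imports "HOL-Analysis.Analysis"
begin

(* The vertex set is the whole finite type 'v, so that vectors and matrices indexed by the
   vertices have types real^'v and real^'v^'v. A graph is given by its set of edges, each edge
   being the set of its two endpoints. *)

definition simple_graph :: "'v::finite set set \<Rightarrow> bool" where
  "simple_graph E \<longleftrightarrow> (\<forall>e\<in>E. card e = 2)"

definition vertex_degree :: "'v::finite set set \<Rightarrow> 'v \<Rightarrow> nat" where
  "vertex_degree E v = card {e \<in> E. v \<in> e}"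

definition num_edges_between :: "'v::finite set set \<Rightarrow> 'v set \<Rightarrow> 'v set \<Rightarrow> nat" where
  "num_edges_between E S T = card {e \<in> E. \<exists>u\<in>S. \<exists>v\<in>T. e = {u, v}}"

definition max_cut :: "'v::finite set set \<Rightarrow> nat" where
  "max_cut E = Max {num_edges_between E A B | A B. A \<inter> B = {}}"

definition degree_matrix :: "'v::finite set set \<Rightarrow> real^'v^'v" where
  "degree_matrix E = (\<chi> i j. if i = j then real (vertex_degree E i) else 0)"

definition adjacency_matrix :: "'v::finite set set \<Rightarrow> real^'v^'v" where
  "adjacency_matrix E = (\<chi> i j. if {i, j} \<in> E then 1 else 0)"

definition qp_objective :: "'v::finite set set \<Rightarrow> real^'v \<Rightarrow> real" where
  "qp_objective E x =
     x \<bullet> ((matrix_inv (degree_matrix E) ** adjacency_matrix E ** matrix_inv (degree_matrix E)) *v x)"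

definition qp_feasible :: "'v::finite set set \<Rightarrow> real^'v \<Rightarrow> bool" where
  "qp_feasible E x \<longleftrightarrow>
     (\<forall>i. 0 \<le> x $ i \<and> x $ i \<le> real (vertex_degree E i)) \<and> (\<Sum>i\<in>UNIV. x $ i) \<ge> real (card E)"

end

theory Submission
  imports Defs
begin

text \<open>
  Put \<open>y i = x i / deg i\<close>. The objective is the sum of \<open>y i * y j\<close> over ordered adjacent pairs
  and the constraint says that the sum of \<open>y i + y j\<close> over these pairs is at least \<open>2 |E|\<close>.
  The indicator of the side of larger volume of a maximum cut shows that the minimum is
  at most \<open>0.01 |E|\<close>. For \<open>y, z\<close> in the unit interval, \<open>2 (y + z) - 1 - 21 y z\<close> is at most 1, and it
  is at most 0 if \<open>y\<close> and \<open>z\<close> lie on the same side of the threshold 0.23; summing this over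
  ordered adjacent pairs bounds the cut of \<open>C\<close> below by \<open>0.895 |E|\<close>.
\<close>

section \<open>Degrees and edge counts as sums over ordered adjacent pairs\<close>

definition adj :: "'v::finite set set \<Rightarrow> 'v \<Rightarrow> 'v \<Rightarrow> real" where
  "adj E i j = (if {i, j} \<in> E then 1 else 0)"

lemma adj_nonneg: "0 \<le> adj E i j"
  by (simp add: adj_def)

lemma adj_commute: "adj E i j = adj E j i"
  by (simp add: adj_def insert_commute)

lemma sum_adj_eq_degree:
  fixes E :: "'v::finite set set"
  assumes "simple_graph E"
  shows "(\<Sum>j\<in>UNIV. adj E i j) = real (vertex_degree E i)"
proof -
  \<comment> \<open>Every edge has exactly two elements, so an edge at \<open>i\<close> is
    determined by its other endpoint.\<close>
  have "bij_betw (\<lambda>j. {i, j}) {j. {i, j} \<in> E} {e \<in> E. i \<in> e}"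
  proof (rule bij_betwI')
    fix e assume e: "e \<in> {e \<in> E. i \<in> e}"
    then have "card e = 2"
      using assms by (auto simp: simple_graph_def)
    with e show "\<exists>j\<in>{j. {i, j} \<in> E}. e = {i, j}"
      by (auto simp: card_2_iff insert_commute)
  qed (auto simp: doubleton_eq_iff)
  then have "card {j. {i, j} \<in> E} = vertex_degree E i"
    by (simp add: bij_betw_same_card vertex_degree_def)
  then show ?thesis
    by (simp add: adj_def sum.If_cases)
qed

text \<open>Double counting of incidences between vertices and edges.\<close>

lemma sum_degree_eq:
  fixes E :: "'v::finite set set"
  assumes "simple_graph E"
  shows "(\<Sum>i\<in>UNIV. real (vertex_degree E i)) = 2 * real (card E)"
proof -
  have "(\<Sum>i\<in>UNIV. vertex_degree E i) = (\<Sum>i\<in>UNIV. \<Sum>e\<in>E. if i \<in> e then 1 else 0)"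
    by (simp add: vertex_degree_def sum.If_cases Int_def)
  also have "\<dots> = (\<Sum>e\<in>E. \<Sum>i\<in>UNIV. if i \<in> e then 1 else 0)"
    by (rule sum.swap)
  also have "\<dots> = (\<Sum>e\<in>E. 2)"
    using assms by (intro sum.cong) (auto simp: sum.If_cases simple_graph_def)
  finally show ?thesis
    by (simp flip: of_nat_sum)
qed

lemma num_edges_between_eq_sum_adj:
  fixes E :: "'v::finite set set"
  assumes "S \<inter> T = {}"
  shows "real (num_edges_between E S T) = (\<Sum>i\<in>S. \<Sum>j\<in>T. adj E i j)"
proof -
  \<comment> \<open>Disjointness of \<open>S\<close> and \<open>T\<close> gives injectivity: an edge
    between them has only one orientation from \<open>S\<close> to \<open>T\<close>.\<close>
  have "bij_betw (\<lambda>(i, j). {i, j}) {p \<in> S \<times> T. {fst p, snd p} \<in> E}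
          {e \<in> E. \<exists>u\<in>S. \<exists>v\<in>T. e = {u, v}}"
    using assms by (intro bij_betwI') (auto simp: doubleton_eq_iff)
  then have "num_edges_between E S T = card {p \<in> S \<times> T. {fst p, snd p} \<in> E}"
    by (simp add: bij_betw_same_card num_edges_between_def)
  also have "real \<dots> = (\<Sum>p\<in>S \<times> T. adj E (fst p) (snd p))"
    by (simp add: adj_def sum.If_cases Int_def)
  finally show ?thesis
    by (simp add: sum.cartesian_product case_prod_beta)
qed

lemma num_edges_between_commute: "num_edges_between E S T = num_edges_between E T S"
  unfolding num_edges_between_def by (rule arg_cong[where f = card]) (auto simp: insert_commute)

section \<open>The objective in coordinates\<close>

lemma matrix_inv_degree_matrix:
  fixes E :: "'v::finite set set"
  assumes "\<And>v. vertex_degree E v > 0"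
  shows "matrix_inv (degree_matrix E) = (\<chi> i j. if i = j then 1 / real (vertex_degree E i) else 0)"
proof -
  let ?M = "\<chi> i j. if i = j then 1 / real (vertex_degree E i) else 0"
  have "real (vertex_degree E v) \<noteq> 0" for v
    using assms[of v] by simp
  then have M: "degree_matrix E ** ?M = mat 1" "?M ** degree_matrix E = mat 1"
    by (simp_all add: vec_eq_iff matrix_matrix_mult_def degree_matrix_def mat_def
        mult_delta_left)
  then have "invertible (degree_matrix E)"
    unfolding invertible_def by blast
  \<comment> \<open>\<open>matrix_inv\<close> is a choice of some two-sided inverse; multiplying by
    the explicit inverse \<open>?M\<close> on the right then identifies it.\<close>
  then have inv: "matrix_inv (degree_matrix E) ** degree_matrix E = mat 1"
    unfolding invertible_def matrix_inv_def by (rule someI2_ex) blast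
  have "matrix_inv (degree_matrix E) = matrix_inv (degree_matrix E) ** (degree_matrix E ** ?M)"
    unfolding M(1) by (rule matrix_mul_rid[symmetric])
  also have "\<dots> = ?M"
    unfolding matrix_mul_assoc inv by (rule matrix_mul_lid)
  finally show ?thesis .
qed

lemma qp_objective_eq:
  fixes E :: "'v::finite set set"
  assumes "\<And>v. vertex_degree E v > 0"
  shows "qp_objective E x = (\<Sum>i\<in>UNIV. \<Sum>j\<in>UNIV. adj E i j *
    (x $ i / real (vertex_degree E i)) * (x $ j / real (vertex_degree E j)))"
proof -
  let ?N = "matrix_inv (degree_matrix E) ** adjacency_matrix E ** matrix_inv (degree_matrix E)"
  have "?N $ i $ j = adj E i j / real (vertex_degree E i) / real (vertex_degree E j)" for i j
    unfolding matrix_inv_degree_matrix[OF assms]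
    by (simp add: matrix_matrix_mult_def adjacency_matrix_def mult_delta_left mult_delta_right
        flip: adj_def)
  then show ?thesis
    by (simp add: qp_objective_def inner_vec_def matrix_vector_mult_def sum_distrib_left mult_ac)
qed

section \<open>Maximum cuts and the minimum of the program\<close>

lemma max_cut_attained:
  fixes E :: "'v::finite set set"
  obtains A B where "A \<inter> B = {}" "max_cut E = num_edges_between E A B"
proof -
  let ?M = "{num_edges_between E A B | A B. A \<inter> B = {}}"
  have "finite ?M"
    by (rule finite_subset[of _ "range (\<lambda>(A, B). num_edges_between E A B)"]) auto
  moreover have "?M \<noteq> {}"
    by blast
  ultimately have "max_cut E \<in> ?M"
    unfolding max_cut_def by (rule Max_in)
  then show thesis
    using that by blast
qed

text \<open>Enlarging \<open>B\<close> to the complement of \<open>A\<close> loses no cut edge. The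
  degrees on the two sides add up to twice the number of edges, so one side carries at least half of
  that; the cut is symmetric, so either side may be chosen.\<close>

lemma max_cut_large_side:
  fixes E :: "'v::finite set set"
  assumes "simple_graph E"
  obtains A where "max_cut E \<le> num_edges_between E A (- A)"
    "real (card E) \<le> (\<Sum>i\<in>A. real (vertex_degree E i))"
proof -
  obtain A B where AB: "A \<inter> B = {}" "max_cut E = num_edges_between E A B"
    by (rule max_cut_attained)
  have cut: "max_cut E \<le> num_edges_between E A (- A)"
    unfolding AB(2) num_edges_between_def using AB(1) by (intro card_mono) auto
  have "(\<Sum>i\<in>A. real (vertex_degree E i)) + (\<Sum>i\<in>-A. real (vertex_degree E i)) = 2 * real (card E)"
    using sum_degree_eq[OF assms] sum.subset_diff[of A UNIV "\<lambda>i. real (vertex_degree E i)"]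
    by (simp add: Compl_eq_Diff_UNIV)
  then consider "real (card E) \<le> (\<Sum>i\<in>A. real (vertex_degree E i))"
    | "real (card E) \<le> (\<Sum>i\<in>-A. real (vertex_degree E i))"
    by linarith
  then show thesis
    using that[of A] that[of "- A"] cut num_edges_between_commute[of E A "- A"] by cases auto
qed

text \<open>All ordered adjacent pairs number \<open>2 * card E\<close>. Each cut edge accounts for
  two of them, and the pairs inside \<open>- A\<close> contribute a nonnegative amount that is
  dropped.\<close>

lemma sum_adj_within_le:
  fixes E :: "'v::finite set set"
  assumes "simple_graph E"
  shows "(\<Sum>i\<in>A. \<Sum>j\<in>A. adj E i j) \<le> 2 * real (card E) - 2 * real (num_edges_between E A (- A))"
proof -
  have split: "sum f UNIV = sum f A + sum f (- A)" for f :: "'v \<Rightarrow> real"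
    using sum.subset_diff[of A UNIV f] by (simp add: Compl_eq_Diff_UNIV)
  have "2 * real (card E) = (\<Sum>i\<in>UNIV. \<Sum>j\<in>UNIV. adj E i j)"
    by (simp add: sum_adj_eq_degree sum_degree_eq assms)
  also have "\<dots> = (\<Sum>i\<in>A. \<Sum>j\<in>A. adj E i j) + (\<Sum>i\<in>A. \<Sum>j\<in>-A. adj E i j)
      + (\<Sum>i\<in>-A. \<Sum>j\<in>A. adj E i j) + (\<Sum>i\<in>-A. \<Sum>j\<in>-A. adj E i j)"
    unfolding split by (simp add: sum.distrib)
  also have "(\<Sum>i\<in>A. \<Sum>j\<in>-A. adj E i j) = real (num_edges_between E A (- A))"
    by (simp add: num_edges_between_eq_sum_adj)
  also have "(\<Sum>i\<in>-A. \<Sum>j\<in>A. adj E i j) = real (num_edges_between E A (- A))"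
    by (subst num_edges_between_commute) (simp add: num_edges_between_eq_sum_adj)
  finally show ?thesis
    using sum_nonneg[of "- A" "\<lambda>i. \<Sum>j\<in>-A. adj E i j"] by (simp add: sum_nonneg adj_nonneg)
qed

lemma qp_minimum_le:
  fixes E :: "'v::finite set set"
  assumes "simple_graph E" and deg: "\<And>v. vertex_degree E v > 0"
    and x: "is_arg_min (qp_objective E) (qp_feasible E) x"
  shows "qp_objective E x \<le> 2 * real (card E) - 2 * real (max_cut E)"
proof -
  obtain A where A: "max_cut E \<le> num_edges_between E A (- A)"
    "real (card E) \<le> (\<Sum>i\<in>A. real (vertex_degree E i))"
    using assms(1) by (rule max_cut_large_side)
  \<comment> \<open>Dividing \<open>z\<close> by the degrees gives the indicator of
    \<open>A\<close>. The volume bound on \<open>A\<close> makes \<open>z\<close> feasible, and its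
    objective counts the ordered adjacent pairs inside \<open>A\<close>.\<close>
  define z :: "real^'v" where "z = (\<chi> i. if i \<in> A then real (vertex_degree E i) else 0)"
  have "qp_feasible E z"
    using A(2) by (simp add: qp_feasible_def z_def sum.If_cases)
  then have "qp_objective E x \<le> qp_objective E z"
    using x by (auto simp: is_arg_min_linorder)
  also have "z $ i / real (vertex_degree E i) = (if i \<in> A then 1 else 0)" for i
    using deg[of i] by (simp add: z_def)
  then have "qp_objective E z =
      (\<Sum>i\<in>UNIV. if i \<in> A then \<Sum>j\<in>UNIV. if j \<in> A then adj E i j else 0 else 0)"
    unfolding qp_objective_eq[OF deg] by (auto intro!: sum.cong)
  then have "qp_objective E z = (\<Sum>i\<in>A. \<Sum>j\<in>A. adj E i j)"
    by (simp add: sum.If_cases)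
  finally show ?thesis
    using sum_adj_within_le[OF assms(1), of A] A(1) by linarith
qed

section \<open>Rounding at the threshold\<close>

text \<open>If both numbers are below 0.23, then \<open>2 * (y + z)\<close> is less than 0.92.
  Otherwise \<open>sum_le\<close> bounds the left side by \<open>1 - 19 * (y * z)\<close>, which is
  at most 1, and negative when both are at least 0.23, as 19 * 0.23 * 0.23 = 1.0051. The coefficient
  21 is the least integer for which this last case works.\<close>

lemma threshold_pair_bound:
  fixes y z :: real
  assumes "0 \<le> y" "y \<le> 1" "0 \<le> z" "z \<le> 1"
  shows "2 * (y + z) - 1 - 21 * (y * z) \<le> (if (0.23 \<le> y) \<noteq> (0.23 \<le> z) then 1 else 0)"
proof -
  have yz: "0 \<le> y * z"
    using assms by simp
  have "0 \<le> (1 - y) * (1 - z)"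
    using assms by simp
  then have sum_le: "y + z \<le> 1 + y * z"
    by (simp add: algebra_simps)
  have "0.23 * 0.23 \<le> y * z" if "0.23 \<le> y" "0.23 \<le> z"
    using that by (intro mult_mono) auto
  with yz sum_le show ?thesis
    by (cases "0.23 \<le> y"; cases "0.23 \<le> z") auto
qed

lemma threshold_cut_ge:
  fixes E :: "'v::finite set set" and y :: "'v \<Rightarrow> real"
  assumes "simple_graph E" and y: "\<And>i. 0 \<le> y i" "\<And>i. y i \<le> 1"
    and vol: "real (card E) \<le> (\<Sum>i\<in>UNIV. real (vertex_degree E i) * y i)"
  defines "C \<equiv> {i. 0.23 \<le> y i}"
  shows "2 * real (card E) - 21 * (\<Sum>i\<in>UNIV. \<Sum>j\<in>UNIV. adj E i j * y i * y j)
    \<le> 2 * real (num_edges_between E C (- C))"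
proof -
  let ?S = "\<lambda>f. \<Sum>i\<in>UNIV. \<Sum>j\<in>UNIV. adj E i j * f i j"
  \<comment> \<open>By symmetry of \<open>adj\<close>, both linear sums equal the degree-weighted
    sum of \<open>y\<close>, which is at least \<open>card E\<close>. With the constant term
    \<open>- 2 * card E\<close>, the linear part of the pair bound is therefore at least
    \<open>4 * card E - 2 * card E\<close>.\<close>
  have deg: "?S (\<lambda>i j. y i) = (\<Sum>i\<in>UNIV. real (vertex_degree E i) * y i)"
    by (simp add: sum_adj_eq_degree assms(1) flip: sum_distrib_right)
  have "?S (\<lambda>i j. y j) = (\<Sum>j\<in>UNIV. \<Sum>i\<in>UNIV. adj E i j * y j)"
    by (rule sum.swap)
  then have deg': "?S (\<lambda>i j. y j) = (\<Sum>i\<in>UNIV. real (vertex_degree E i) * y i)"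
    unfolding deg[symmetric] by (simp add: adj_commute)
  have "2 * ?S (\<lambda>i j. y i) + 2 * ?S (\<lambda>i j. y j) - ?S (\<lambda>i j. 1) - 21 * ?S (\<lambda>i j. y i * y j)
      = ?S (\<lambda>i j. 2 * (y i + y j) - 1 - 21 * (y i * y j))"
    by (simp add: algebra_simps sum.distrib sum_subtractf sum_distrib_left)
  also have "\<dots> \<le> ?S (\<lambda>i j. if (i \<in> C) \<noteq> (j \<in> C) then 1 else 0)"
    unfolding C_def mem_Collect_eq
    by (intro sum_mono mult_left_mono adj_nonneg threshold_pair_bound y)
  \<comment> \<open>Separated pairs are split by orientation, so each cut edge is counted
    twice.\<close>
  also have "\<dots> = (\<Sum>i\<in>UNIV. \<Sum>j\<in>UNIV. (if i \<in> C then if j \<in> - C then adj E i j else 0 else 0)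
      + (if i \<in> - C then if j \<in> C then adj E i j else 0 else 0))"
    by (intro sum.cong) auto
  also have "\<dots> = (\<Sum>i\<in>C. \<Sum>j\<in>-C. adj E i j) + (\<Sum>i\<in>-C. \<Sum>j\<in>C. adj E i j)"
    unfolding sum.distrib by (simp add: sum.If_cases if_distrib[of "sum _"] flip: Compl_eq cong: if_cong)
  also have "\<dots> = real (num_edges_between E C (- C)) + real (num_edges_between E (- C) C)"
    by (simp add: num_edges_between_eq_sum_adj)
  also have "\<dots> = 2 * real (num_edges_between E C (- C))"
    by (simp add: num_edges_between_commute[of E "- C"])
  finally show ?thesis
    using vol by (simp add: deg deg' sum_adj_eq_degree sum_degree_eq assms(1) mult.assoc)
qed

theorem mainTheorem1:
  fixes E :: "'v::finite set set"
    and x :: "real^'v"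
    and C :: "'v set"
  assumes "simple_graph E"
    and "\<And>v. vertex_degree E v > 0"
    and "is_arg_min (qp_objective E) (qp_feasible E) x"
    and "C = {i. x $ i \<ge> 0.23 * real (vertex_degree E i)}"
    and "real (max_cut E) \<ge> 0.995 * real (card E)"
  shows "real (num_edges_between E C (UNIV - C)) \<ge> 0.502 * real (max_cut E)"
proof -
  define y where "y i = x $ i / real (vertex_degree E i)" for i
  have pos: "0 < real (vertex_degree E i)" for i
    using assms(2) by simp
  have "qp_feasible E x"
    using assms(3) by (simp add: is_arg_min_def)
  then have feas: "0 \<le> x $ i" "x $ i \<le> real (vertex_degree E i)"
    "real (card E) \<le> (\<Sum>i\<in>UNIV. x $ i)" for i
    by (auto simp: qp_feasible_def)
  have xy: "real (vertex_degree E i) * y i = x $ i" for i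
    using pos[of i] by (simp add: y_def)
  have y: "0 \<le> y i" "y i \<le> 1" for i
    using feas(1,2)[of i] pos[of i] by (simp_all add: y_def)
  have C: "C = {i. 0.23 \<le> y i}"
    unfolding assms(4) y_def using pos by (simp add: pos_le_divide_eq)
  have "2 * real (card E) - 21 * qp_objective E x \<le> 2 * real (num_edges_between E C (- C))"
    using threshold_cut_ge[OF assms(1) y] feas(3)
    by (simp add: qp_objective_eq[OF assms(2)] C xy flip: y_def)
  moreover have "qp_objective E x \<le> 2 * real (card E) - 2 * real (max_cut E)"
    using assms(1-3) by (rule qp_minimum_le)
  \<comment> \<open>The preceding bounds give a cut of at least
    \<open>21 * max_cut E - 20 * card E\<close>, hence at least \<open>0.895 * card E\<close>. This
    inequality turns that into a multiple of \<open>max_cut E\<close>, well above the factor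
    0.502.\<close>
  moreover have "max_cut E \<le> card E"
    by (rule max_cut_attained[of E]) (auto simp: num_edges_between_def intro: card_mono)
  ultimately show ?thesis
    using assms(5) by (simp add: Compl_eq_Diff_UNIV)
qed

end
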